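(* For two Maker-Breaker poset positional games $\mathcal{G}_1,\mathcal{G}_2$ of given parities and given outcomes, the set of outcomes that the disjoint union $\mathcal{G}_1\cup\mathcal{G}_2$ can have (i.e. the outcomes realized by some such pair, and only these) is as follows, writing "$o_1,o_2$: list" for $o(\mathcal{G}_1)=o_1$, $o(\mathcal{G}_2)=o_2$ (the relation is symmetric in the two games). Both even: $\mathcal{M},\mathcal{M}$: $\mathcal{M}$; $\mathcal{M},\mathcal{N}$: $\mathcal{M}$; $\mathcal{M},\mathcal{P}$: $\mathcal{M}$; $\mathcal{M},\mathcal{B}$: $\mathcal{M}$; $\mathcal{N},\mathcal{N}$: $\mathcal{M},\mathcal{N}$; $\mathcal{N},\mathcal{P}$: $\mathcal{M}$; $\mathcal{N},\mathcal{B}$: $\mathcal{M},\mathcal{N}$; $\mathcal{P},\mathcal{P}$: $\mathcal{P}$; $\mathcal{P},\mathcal{B}$: $\mathcal{P}$; $\mathcal{B},\mathcal{B}$: $\mathcal{P},\mathcal{B}$. $\mathcal{G}_1$ even, $\mathcal{G}_2$ odd: $\mathcal{M},\mathcal{M}$: $\mathcal{M}$; $\mathcal{M},\mathcal{N}$: $\mathcal{M},\mathcal{N}$; $\mathcal{M},\mathcal{P}$: $\mathcal{M}$; $\mathcal{M},\mathcal{B}$: $\mathcal{M},\mathcal{N}$; $\mathcal{N},\mathcal{M}$: $\mathcal{M}$; $\mathcal{N},\mathcal{N}$: $\mathcal{M},\mathcal{N}$; $\mathcal{N},\mathcal{P}$: $\mathcal{M}$; $\mathcal{N},\mathcal{B}$: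 all four outcomes; $\mathcal{P},\mathcal{M}$: $\mathcal{M}$; $\mathcal{P},\mathcal{N}$: $\mathcal{N}$; $\mathcal{P},\mathcal{P}$: $\mathcal{M}$; $\mathcal{P},\mathcal{B}$: $\mathcal{N}$; $\mathcal{B},\mathcal{M}$: $\mathcal{M}$; $\mathcal{B},\mathcal{N}$: $\mathcal{N}$; $\mathcal{B},\mathcal{P}$: $\mathcal{M},\mathcal{P}$; $\mathcal{B},\mathcal{B}$: $\mathcal{N},\mathcal{B}$. Both odd: $\mathcal{M},\mathcal{M}$: $\mathcal{M}$; $\mathcal{M},\mathcal{N}$: $\mathcal{M}$; $\mathcal{M},\mathcal{P}$: $\mathcal{M}$; $\mathcal{M},\mathcal{B}$: $\mathcal{M},\mathcal{N}$; $\mathcal{N},\mathcal{N}$: $\mathcal{M},\mathcal{P}$; $\mathcal{N},\mathcal{P}$: $\mathcal{M},\mathcal{N}$; $\mathcal{N},\mathcal{B}$: all four outcomes; $\mathcal{P},\mathcal{P}$: $\mathcal{M}$; $\mathcal{P},\mathcal{B}$: $\mathcal{M},\mathcal{N}$; $\mathcal{B},\mathcal{B}$: all four outcomes.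
   Context: A poset positional game is a triple $(X,\mathcal{F},P)$ with $X$ a finite board of vertices, $\mathcal{F}\subseteq 2^X$ the winning sets, and $P$ a partial order on $X$. Two players alternately claim an unclaimed vertex $v$ such that all vertices smaller than $v$ in $P$ are already claimed, until all vertices are claimed. In the Maker-Breaker convention, Maker wins if she claims all vertices of some winning set; otherwise Breaker wins. Either player may start. The outcome $o(\mathcal{G})$ is $\mathcal{M}$ if Maker has a winning strategy whoever starts, $\mathcal{B}$ if Breaker has a winning strategy whoever starts, $\mathcal{N}$ if the first player has a winning strategy, and $\mathcal{P}$ if the second player has a winning strategy. A game is even (resp. odd) if its board has an even (resp. odd) number of vertices. The disjoint union of games on disjoint boards has as board the union of boards, as winning sets the union of the families, and as poset the union of the posets with elements of different games incomparable. *)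

theory Defs
  imports Main
begin

record 'a ppg =
  board :: "'a set"
  winning_sets :: "'a set set"
  order :: "'a rel"

definition poset_game :: "'a ppg \<Rightarrow> bool" where
  "poset_game G \<longleftrightarrow> finite (board G) \<and> winning_sets G \<subseteq> Pow (board G)
     \<and> partial_order_on (board G) (order G)"

datatype player = Maker | Breaker

fun opponent :: "player \<Rightarrow> player" where
  "opponent Maker = Breaker"
| "opponent Breaker = Maker"

text \<open>A play is recorded as the list of claimed vertices in chronological order; the owner of
  each vertex is determined by its position in the list and by the player who starts.\<close>

definition mover :: "player \<Rightarrow> nat \<Rightarrow> player" where
  "mover s k = (if even k then s else opponent s)"

definition available :: "'a ppg \<Rightarrow> 'a list \<Rightarrow> 'a \<Rightarrow> bool" where
  "available G h v \<longleftrightarrow> v \<in> board G \<and> v \<notin> set h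
     \<and> (\<forall>u. (u, v) \<in> order G \<and> u \<noteq> v \<longrightarrow> u \<in> set h)"

definition legal_play :: "'a ppg \<Rightarrow> 'a list \<Rightarrow> bool" where
  "legal_play G h \<longleftrightarrow> (\<forall>i < length h. available G (take i h) (h ! i))"

definition claimed :: "player \<Rightarrow> player \<Rightarrow> 'a list \<Rightarrow> 'a set" where
  "claimed s p h = {h ! i | i. i < length h \<and> mover s i = p}"

text \<open>The winner \<open>p\<close> of a complete play \<open>h\<close> started by \<open>s\<close>.\<close>

fun won_by :: "'a ppg \<Rightarrow> player \<Rightarrow> player \<Rightarrow> 'a list \<Rightarrow> bool" where
  "won_by G s Maker h \<longleftrightarrow> (\<exists>W \<in> winning_sets G. W \<subseteq> claimed s Maker h)"
| "won_by G s Breaker h \<longleftrightarrow> \<not> (\<exists>W \<in> winning_sets G. W \<subseteq> claimed s Maker h)"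

definition follows :: "player \<Rightarrow> player \<Rightarrow> ('a list \<Rightarrow> 'a) \<Rightarrow> 'a list \<Rightarrow> bool" where
  "follows s p \<sigma> h \<longleftrightarrow> (\<forall>i < length h. mover s i = p \<longrightarrow> h ! i = \<sigma> (take i h))"

text \<open>A strategy maps the play so far to the next vertex. It must prescribe an available vertex
  whenever its owner has to move; otherwise a strategy proposing illegal moves would win
  vacuously.\<close>

definition winning_strategy :: "'a ppg \<Rightarrow> player \<Rightarrow> player \<Rightarrow> ('a list \<Rightarrow> 'a) \<Rightarrow> bool" where
  "winning_strategy G s p \<sigma> \<longleftrightarrow>
     (\<forall>h. legal_play G h \<and> follows s p \<sigma> h \<longrightarrow>
        (if set h = board G then won_by G s p h
         else mover s (length h) = p \<longrightarrow> available G h (\<sigma> h)))"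

definition can_win :: "'a ppg \<Rightarrow> player \<Rightarrow> player \<Rightarrow> bool" where
  "can_win G s p \<longleftrightarrow> (\<exists>\<sigma>. winning_strategy G s p \<sigma>)"

datatype outcome = \<M> | \<N> | \<P> | \<B>

fun has_outcome :: "'a ppg \<Rightarrow> outcome \<Rightarrow> bool" where
  "has_outcome G \<M> \<longleftrightarrow> (\<forall>s. can_win G s Maker)"
| "has_outcome G \<N> \<longleftrightarrow> (\<forall>s. can_win G s s)"
| "has_outcome G \<P> \<longleftrightarrow> (\<forall>s. can_win G s (opponent s))"
| "has_outcome G \<B> \<longleftrightarrow> (\<forall>s. can_win G s Breaker)"

text \<open>Finite games are determined, so a poset game belongs to exactly one of the four classes.\<close>

definition outcome_of :: "'a ppg \<Rightarrow> outcome" where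
  "outcome_of G = (THE c. has_outcome G c)"

datatype parity = Even | Odd

definition parity_of :: "'a ppg \<Rightarrow> parity" where
  "parity_of G = (if even (card (board G)) then Even else Odd)"

text \<open>Only meant for games with disjoint boards.\<close>

definition game_union :: "'a ppg \<Rightarrow> 'a ppg \<Rightarrow> 'a ppg" where
  "game_union G H = \<lparr>board = board G \<union> board H,
     winning_sets = winning_sets G \<union> winning_sets H,
     order = order G \<union> order H\<rparr>"

definition union_outcomes ::
    "'a itself \<Rightarrow> parity \<Rightarrow> outcome \<Rightarrow> parity \<Rightarrow> outcome \<Rightarrow> outcome set" where
  "union_outcomes _ p\<^sub>1 c\<^sub>1 p\<^sub>2 c\<^sub>2 =
     {outcome_of (game_union G\<^sub>1 G\<^sub>2) | G\<^sub>1 G\<^sub>2 :: 'a ppg.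
        poset_game G\<^sub>1 \<and> poset_game G\<^sub>2 \<and> board G\<^sub>1 \<inter> board G\<^sub>2 = {} \<and>
        parity_of G\<^sub>1 = p\<^sub>1 \<and> outcome_of G\<^sub>1 = c\<^sub>1 \<and>
        parity_of G\<^sub>2 = p\<^sub>2 \<and> outcome_of G\<^sub>2 = c\<^sub>2}"

end

theory Submission
  imports Defs "HOL-Library.Nat_Bijection"
begin

text \<open>Claiming a vertex leaves a smaller poset game, so by induction on the board either Maker or
  Breaker wins, and the outcome is given by whether Maker wins as first and as second player. All
  restrictions on the outcome of a union come from answering in the component in which the opponent
  has just moved. Maker can be forced out of this only when a component is full, which is harmless
  if her play there has already completed a winning set, or is excluded by parity; Breaker has to
  win in both components and relies on parity alone. Every outcome respecting these restrictions
  is realized by small games, whose trees are evaluated explicitly.\<close>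

text \<open>A play of a union interleaves plays of its components, and within one component the same
  player may move twice in a row, so strategies given on histories cannot simply be merged.
  Histories are therefore eliminated early: a position becomes a game on the unclaimed vertices, and
  of each game only two truth values are kept, namely whether Maker wins when she starts and whether
  she wins when Breaker starts. Arguments about unions are then inductions on the number of
  unclaimed vertices. Parity enters through a single fact: a move in an even component leaves an odd
  number of vertices, hence a nonempty board with a minimal vertex, so an answer in the same
  component exists. The strategic arguments amount to eight implications between truth values and
  parities. That nothing else restricts the outcome is not argued but checked: each outcome they
  allow is exhibited, and the game trees are evaluated by rewriting inside the logic.\<close>

lemma opponent_opponent [simp]: "opponent (opponent s) = s"
  by (cases s) auto

lemma opponent_neq [simp]: "opponent s \<noteq> s" "s \<noteq> opponent s"
  by (cases s; simp)+

text \<open>This is the residual game after a move. A winning set is read as what Maker still needs: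
  her own claim shortens it, a claim by Breaker destroys it. Hence \<open>{}\<close> in the family
  says that Maker has already won, and an empty family that she has already lost.\<close>

definition claim :: "player \<Rightarrow> 'a \<Rightarrow> 'a ppg \<Rightarrow> 'a ppg" where
  "claim p v G = \<lparr>board = board G - {v},
     winning_sets = (if p = Maker then (\<lambda>W. W - {v}) ` winning_sets G
                     else {W \<in> winning_sets G. v \<notin> W}),
     order = {(x, y) \<in> order G. x \<noteq> v \<and> y \<noteq> v}\<rparr>"

abbreviation playable :: "'a ppg \<Rightarrow> 'a \<Rightarrow> bool" where
  "playable G v \<equiv> available G [] v"

lemma board_claim [simp]: "board (claim p v G) = board G - {v}"
  by (simp add: claim_def)

lemma playable_in_board: "playable G v \<Longrightarrow> v \<in> board G"
  by (simp add: available_def)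

lemma finite_board: "poset_game G \<Longrightarrow> finite (board G)"
  by (simp add: poset_game_def)

lemma poset_game_claim:
  assumes "poset_game G"
  shows "poset_game (claim p v G)"
  using assms unfolding poset_game_def claim_def
  by (auto simp: order_on_defs refl_on_def trans_def antisym_def)

lemma card_claim:
  "poset_game G \<Longrightarrow> playable G v \<Longrightarrow> card (board G) = Suc (card (board (claim p v G)))"
  by (simp add: card_Suc_Diff1 finite_board playable_in_board del: card_Diff_insert)

lemma card_claim_less:
  "poset_game G \<Longrightarrow> playable G v \<Longrightarrow> card (board (claim p v G)) < card (board G)"
  by (metis card_claim lessI)

text \<open>The strict part of a finite partial order is well-founded, so a nonempty board has a
  minimal vertex. Play never gets stuck before the board is full.\<close>

lemma exists_playable:
  assumes G: "poset_game G" and "board G \<noteq> {}"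
  shows "\<exists>v. playable G v"
proof -
  from G have po: "partial_order_on (board G) (order G)" and fin: "finite (board G)"
    by (auto simp: poset_game_def)
  have sub: "order G \<subseteq> board G \<times> board G"
    using po by (rule partial_order_onD)
  have "finite (order G)"
    using sub fin finite_subset by blast
  then have "wf (order G - Id)"
    using po by (rule partial_order_on_well_order_on)
  from wfE_min'[OF this assms(2)] obtain v
    where "v \<in> board G" "\<And>u. (u, v) \<in> order G - Id \<Longrightarrow> u \<notin> board G" by blast
  then show ?thesis
    using sub by (auto simp: available_def)
qed

subsection \<open>Recursion over the first move, and determinacy\<close>

lemma mover_Suc: "mover s (Suc k) = mover (opponent s) k"
  by (simp add: mover_def)

lemma in_claimed: "x \<in> claimed s p h \<longleftrightarrow> (\<exists>i < length h. x = h ! i \<and> mover s i = p)"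
  by (auto simp: claimed_def)

lemma claimed_Cons:
  "claimed s p (v # h) = (if s = p then {v} else {}) \<union> claimed (opponent s) p h"
  by (rule set_eqI)
    (simp add: in_claimed Ex_less_Suc2 mover_Suc, simp add: mover_def)

lemma claimed_subset: "claimed s p h \<subseteq> set h"
  by (auto simp: claimed_def)

lemma available_Cons: "available G (v # h) u \<longleftrightarrow> available (claim p v G) h u"
  by (auto simp: available_def claim_def)

text \<open>Ownership affects the winning sets but not availability, so any \<open>p\<close> serves
  on the right. As \<open>p\<close> does not occur on the left, each use instantiates it.\<close>

lemma legal_play_Cons:
  "legal_play G (v # h) \<longleftrightarrow> playable G v \<and> legal_play (claim p v G) h"
  unfolding legal_play_def length_Cons All_less_Suc2
  by (auto simp: available_Cons[of _ _ _ _ p])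

lemma legal_play_subset: "legal_play G h \<Longrightarrow> set h \<subseteq> board G"
  by (auto simp: legal_play_def available_def in_set_conv_nth)

lemma follows_Cons:
  "follows s p \<sigma> (v # h) \<longleftrightarrow>
     (s = p \<longrightarrow> v = \<sigma> []) \<and> follows (opponent s) p (\<lambda>h. \<sigma> (v # h)) h"
  unfolding follows_def length_Cons All_less_Suc2 by (simp add: mover_Suc) (simp add: mover_def)

lemma won_by_Cons:
  assumes "legal_play G (v # h)"
  shows "won_by G s p (v # h) \<longleftrightarrow> won_by (claim s v G) (opponent s) p h"
proof -
  have "v \<notin> set h"
    using assms legal_play_subset[of "claim s v G" h] by (auto simp: legal_play_Cons[of _ _ _ s])
  \<comment> \<open>This settles the case where Breaker claimed \<open>v\<close>: a winning set
    containing \<open>v\<close> can no longer be completed, so dropping it changes nothing.\<close>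
  then have "v \<notin> claimed Maker Maker h"
    using claimed_subset by fast
  then have "(\<exists>W\<in>winning_sets G. W \<subseteq> claimed s Maker (v # h)) \<longleftrightarrow>
    (\<exists>W\<in>winning_sets (claim s v G). W \<subseteq> claimed (opponent s) Maker h)"
    by (cases s) (auto simp: claimed_Cons claim_def)
  then show ?thesis
    by (cases p) simp_all
qed

lemma all_list_iff: "(\<forall>h. P h) \<longleftrightarrow> P [] \<and> (\<forall>v h. P (v # h))"
  by (metis list.exhaust)

text \<open>Splitting the histories into \<open>[]\<close> and \<open>v # h\<close> separates the
  duty to open legally from the play of the residual game. A nonempty board ensures that
  \<open>[]\<close> is not a complete play.\<close>

lemma winning_strategy_first_move:
  assumes "board G \<noteq> {}"
  shows "winning_strategy G s p \<sigma> \<longleftrightarrow>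
    (s = p \<longrightarrow> playable G (\<sigma> [])) \<and>
    (\<forall>v. playable G v \<and> (s = p \<longrightarrow> v = \<sigma> []) \<longrightarrow>
       winning_strategy (claim s v G) (opponent s) p (\<lambda>h. \<sigma> (v # h)))"
    (is "_ \<longleftrightarrow> ?first \<and> ?rest")
proof -
  define Q where "Q h \<longleftrightarrow> (legal_play G h \<and> follows s p \<sigma> h \<longrightarrow>
        (if set h = board G then won_by G s p h
         else mover s (length h) = p \<longrightarrow> available G h (\<sigma> h)))" for h
  define Q' where "Q' v h \<longleftrightarrow> (legal_play (claim s v G) h \<and>
        follows (opponent s) p (\<lambda>h. \<sigma> (v # h)) h \<longrightarrow>
        (if set h = board G - {v} then won_by (claim s v G) (opponent s) p h
         else mover (opponent s) (length h) = p \<longrightarrow> available (claim s v G) h (\<sigma> (v # h))))" for v h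
  have Nil: "Q [] \<longleftrightarrow> ?first"
    using assms by (auto simp: Q_def legal_play_def follows_def mover_def)
  have Cons: "Q (v # h) \<longleftrightarrow> (playable G v \<and> (s = p \<longrightarrow> v = \<sigma> []) \<longrightarrow> Q' v h)" for v h
  proof (cases "legal_play G (v # h)")
    case True
    then have v: "playable G v" and h: "set h \<subseteq> board G - {v}"
      using legal_play_subset[of "claim s v G" h] by (simp_all add: legal_play_Cons[of _ _ _ s])
    from v h have "set (v # h) = board G \<longleftrightarrow> set h = board G - {v}"
      by (auto dest: playable_in_board)
    then show ?thesis
      using True v unfolding Q_def Q'_def
      by (simp add: won_by_Cons mover_Suc follows_Cons available_Cons[of _ _ _ _ s]
          legal_play_Cons[of _ _ _ s]) blast
  next
    case False
    then show ?thesis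
      by (auto simp: Q_def Q'_def legal_play_Cons[of _ _ _ s])
  qed
  have "winning_strategy G s p \<sigma> \<longleftrightarrow> (\<forall>h. Q h)"
    by (simp only: winning_strategy_def Q_def)
  also have "\<dots> \<longleftrightarrow> ?first \<and> (\<forall>v. playable G v \<and> (s = p \<longrightarrow> v = \<sigma> []) \<longrightarrow> (\<forall>h. Q' v h))"
    by (subst all_list_iff) (use Nil Cons in blast)
  also have "(\<lambda>v. \<forall>h. Q' v h) =
      (\<lambda>v. winning_strategy (claim s v G) (opponent s) p (\<lambda>h. \<sigma> (v # h)))"
    by (simp add: winning_strategy_def Q'_def)
  finally show ?thesis .
qed

lemma can_win_own_move:
  assumes "board G \<noteq> {}"
  shows "can_win G s s \<longleftrightarrow> (\<exists>v. playable G v \<and> can_win (claim s v G) (opponent s) s)"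
proof
  assume "can_win G s s"
  then show "\<exists>v. playable G v \<and> can_win (claim s v G) (opponent s) s"
    unfolding can_win_def winning_strategy_first_move[OF assms] by blast
next
  assume "\<exists>v. playable G v \<and> can_win (claim s v G) (opponent s) s"
  then obtain v \<sigma> where "playable G v" "winning_strategy (claim s v G) (opponent s) s \<sigma>"
    unfolding can_win_def by blast
  then have "winning_strategy G s s (\<lambda>h. case h of [] \<Rightarrow> v | _ # h' \<Rightarrow> \<sigma> h')"
    by (simp add: winning_strategy_first_move[OF assms])
  then show "can_win G s s"
    unfolding can_win_def by blast
qed

lemma can_win_opponent_move:
  assumes "board G \<noteq> {}" and "s \<noteq> p"
  shows "can_win G s p \<longleftrightarrow> (\<forall>v. playable G v \<longrightarrow> can_win (claim s v G) (opponent s) p)"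
proof
  assume "can_win G s p"
  then show "\<forall>v. playable G v \<longrightarrow> can_win (claim s v G) (opponent s) p"
    unfolding can_win_def winning_strategy_first_move[OF assms(1)] using assms(2) by blast
next
  assume "\<forall>v. playable G v \<longrightarrow> can_win (claim s v G) (opponent s) p"
  then obtain \<tau> where
    "\<And>v. playable G v \<Longrightarrow> winning_strategy (claim s v G) (opponent s) p (\<tau> v)"
    unfolding can_win_def by metis
  \<comment> \<open>The opponent's opening vertex selects the residual strategy. The value at
    \<open>[]\<close> is never consulted, since \<open>p\<close> does not open.\<close>
  then have "winning_strategy G s p (\<lambda>h. case h of [] \<Rightarrow> undefined | v # h' \<Rightarrow> \<tau> v h')"
    using assms by (simp add: winning_strategy_first_move)
  then show "can_win G s p"
    unfolding can_win_def by blast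
qed

lemma can_win_empty_board:
  assumes "board G = {}"
  shows "can_win G s p \<longleftrightarrow> won_by G s p []"
proof -
  have "h = []" if "legal_play G h" for h
    using legal_play_subset[OF that] assms by simp
  then show ?thesis
    by (auto simp: can_win_def winning_strategy_def assms legal_play_def follows_def)
qed

section \<open>The value of a position for Maker, and determinacy\<close>

abbreviation maker_wins :: "'a ppg \<Rightarrow> player \<Rightarrow> bool" where
  "maker_wins G s \<equiv> can_win G s Maker"

lemma maker_wins_empty_board: "board G = {} \<Longrightarrow> maker_wins G s \<longleftrightarrow> {} \<in> winning_sets G"
  by (auto simp: can_win_empty_board claimed_def)

lemma maker_wins_Maker:
  assumes "board G \<noteq> {}"
  shows "maker_wins G Maker \<longleftrightarrow> (\<exists>v. playable G v \<and> maker_wins (claim Maker v G) Breaker)"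
  using can_win_own_move[OF assms, of Maker] by simp

lemma maker_wins_Breaker:
  assumes "board G \<noteq> {}"
  shows "maker_wins G Breaker \<longleftrightarrow> (\<forall>v. playable G v \<longrightarrow> maker_wins (claim Breaker v G) Maker)"
  using can_win_opponent_move[OF assms, of Breaker Maker] by simp

text \<open>Zermelo's backward induction: negation exchanges the existential choice of the player to
  move with the universal one of the player who waits.\<close>

lemma determinacy:
  assumes "poset_game G"
  shows "can_win G s Breaker \<longleftrightarrow> \<not> maker_wins G s"
  using assms
proof (induction "card (board G)" arbitrary: G s rule: less_induct)
  case less
  show ?case
  proof (cases "board G = {}")
    case True
    then show ?thesis
      by (simp add: can_win_empty_board)
  next
    case False
    note IH = less.hyps[OF card_claim_less[OF less.prems] poset_game_claim[OF less.prems]]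
    show ?thesis
    proof (cases s)
      case Maker
      then show ?thesis
        using IH can_win_opponent_move[OF False, of Maker Breaker] maker_wins_Maker[OF False]
        by auto
    next
      case Breaker
      then show ?thesis
        using IH can_win_own_move[OF False, of Breaker] maker_wins_Breaker[OF False]
        by auto
    qed
  qed
qed

text \<open>Determinacy turns each winning claim for Breaker into a negated one for Maker. The four
  classes are then the four combinations of two truth values, so the description in
  \<open>outcome_of\<close> is unique.\<close>

lemma outcome_of_eq:
  assumes "poset_game G"
  shows "outcome_of G =
    (if maker_wins G Maker then if maker_wins G Breaker then \<M> else \<N>
     else if maker_wins G Breaker then \<P> else \<B>)"
proof -
  have all_player: "(\<forall>s. P s) \<longleftrightarrow> P Maker \<and> P Breaker" for P
    by (metis player.exhaust)
  have "has_outcome G c \<longleftrightarrow> c = (if maker_wins G Maker then if maker_wins G Breaker then \<M> else \<N>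
     else if maker_wins G Breaker then \<P> else \<B>)" for c
    by (cases c) (simp_all add: all_player determinacy[OF assms])
  then show ?thesis
    by (simp add: outcome_of_def)
qed

text \<open>Neither kind of claim removes \<open>{}\<close> from the family, so the win survives any
  continuation. Play may thus be cut off as soon as a winning set is complete.\<close>

lemma maker_wins_if_won:
  assumes "poset_game G" and "{} \<in> winning_sets G"
  shows "maker_wins G s"
  using assms
proof (induction "card (board G)" arbitrary: G s rule: less_induct)
  case less
  have sub: "{} \<in> winning_sets (claim p v G)" for p v
    using less.prems(2) by (force simp: claim_def)
  note IH = less.hyps[OF card_claim_less[OF less.prems(1)] poset_game_claim[OF less.prems(1)] sub]
  show ?case
  proof (cases "board G = {}")
    case True
    then show ?thesis
      using less.prems(2) by (simp add: maker_wins_empty_board)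
  next
    case False
    then show ?thesis
      using IH exists_playable[OF less.prems(1) False]
      by (cases s) (auto simp: maker_wins_Maker maker_wins_Breaker)
  qed
qed

lemma not_maker_wins_if_lost:
  assumes "poset_game G" and "winning_sets G = {}"
  shows "\<not> maker_wins G s"
  using assms
proof (induction "card (board G)" arbitrary: G s rule: less_induct)
  case less
  have sub: "winning_sets (claim p v G) = {}" for p v
    using less.prems(2) by (simp add: claim_def)
  note IH = less.hyps[OF card_claim_less[OF less.prems(1)] poset_game_claim[OF less.prems(1)] sub]
  show ?case
  proof (cases "board G = {}")
    case True
    then show ?thesis
      using less.prems(2) by (simp add: maker_wins_empty_board)
  next
    case False
    then show ?thesis
      using IH exists_playable[OF less.prems(1) False]
      by (cases s) (auto simp: maker_wins_Maker maker_wins_Breaker)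
  qed
qed

subsection \<open>Disjoint unions\<close>

definition disjoint_games :: "'a ppg \<Rightarrow> 'a ppg \<Rightarrow> bool" where
  "disjoint_games G H \<longleftrightarrow> poset_game G \<and> poset_game H \<and> board G \<inter> board H = {}"

lemma disjoint_gamesD:
  assumes "disjoint_games G H"
  shows "poset_game G" "poset_game H" "disjoint_games H G"
  using assms by (auto simp: disjoint_games_def)

lemma disjoint_games_claim:
  assumes "disjoint_games G H"
  shows "disjoint_games (claim p v G) H" "disjoint_games G (claim p v H)"
  using assms by (auto simp: disjoint_games_def poset_game_claim)

lemma board_union [simp]: "board (game_union G H) = board G \<union> board H"
  by (simp add: game_union_def)

lemma winning_sets_union [simp]:
  "winning_sets (game_union G H) = winning_sets G \<union> winning_sets H"
  by (simp add: game_union_def)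

lemma game_union_commute: "game_union G H = game_union H G"
  by (auto simp: game_union_def)

lemma order_subset: "poset_game G \<Longrightarrow> order G \<subseteq> board G \<times> board G"
  unfolding poset_game_def by (blast dest: partial_order_onD(4))

lemma poset_game_union:
  assumes "disjoint_games G H"
  shows "poset_game (game_union G H)"
proof -
  from assms have dis: "board G \<inter> board H = {}"
    and fin: "finite (board G)" "finite (board H)"
    and ws: "winning_sets G \<subseteq> Pow (board G)" "winning_sets H \<subseteq> Pow (board H)"
    and po: "partial_order_on (board G) (order G)" "partial_order_on (board H) (order H)"
    by (auto simp: disjoint_games_def poset_game_def)
  note sub = partial_order_onD(4)[OF po(1)] partial_order_onD(4)[OF po(2)]
  have "refl_on (board G \<union> board H) (order G \<union> order H)"
    using partial_order_onD(1)[OF po(1)] partial_order_onD(1)[OF po(2)] by (auto simp: refl_on_def)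
  moreover have "trans (order G \<union> order H)"
    by (rule transI)
      (use sub dis transD[OF partial_order_onD(2)[OF po(1)]] transD[OF partial_order_onD(2)[OF po(2)]]
        in blast)
  moreover have "antisym (order G \<union> order H)"
    by (rule antisymI)
      (use sub dis antisymD[OF partial_order_onD(3)[OF po(1)]]
        antisymD[OF partial_order_onD(3)[OF po(2)]] in blast)
  moreover have "order G \<union> order H \<subseteq> (board G \<union> board H) \<times> (board G \<union> board H)"
    using sub by blast
  moreover have "winning_sets G \<union> winning_sets H \<subseteq> Pow (board G \<union> board H)"
    using ws by blast
  ultimately show ?thesis
    using fin by (simp add: poset_game_def game_union_def order_on_defs)
qed

lemma playable_union:
  assumes "disjoint_games G H"
  shows "playable (game_union G H) v \<longleftrightarrow> playable G v \<or> playable H v"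
  using assms order_subset[of G] order_subset[of H]
  by (auto simp: available_def game_union_def disjoint_games_def)

text \<open>The winning sets and the order of \<open>H\<close> live on its own board, which does not
  contain \<open>v\<close>, so the move leaves them alone.\<close>

lemma claim_union_left:
  assumes "disjoint_games G H" and "playable G v"
  shows "claim p v (game_union G H) = game_union (claim p v G) H"
proof -
  have v: "v \<notin> board H"
    using assms by (auto simp: disjoint_games_def dest: playable_in_board)
  have H: "winning_sets H \<subseteq> Pow (board H)" "order H \<subseteq> board H \<times> board H"
    using assms order_subset[of H] by (auto simp: disjoint_games_def poset_game_def)
  have "board G \<union> board H - {v} = board G - {v} \<union> board H"
    using v by blast
  moreover have "W - {v} = W" if "W \<in> winning_sets H" for W
    using that v H(1) by blast
  then have "(\<lambda>W. W - {v}) ` (winning_sets G \<union> winning_sets H) =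
      (\<lambda>W. W - {v}) ` winning_sets G \<union> winning_sets H"
    by (simp add: image_Un)
  moreover have "{W \<in> winning_sets G \<union> winning_sets H. v \<notin> W} =
      {W \<in> winning_sets G. v \<notin> W} \<union> winning_sets H"
    using v H(1) by blast
  moreover have "{(x, y) \<in> order G \<union> order H. x \<noteq> v \<and> y \<noteq> v} =
      {(x, y) \<in> order G. x \<noteq> v \<and> y \<noteq> v} \<union> order H"
    using v H(2) by blast
  ultimately show ?thesis
    by (simp add: claim_def game_union_def)
qed

lemma claim_union_right:
  assumes "disjoint_games G H" and "playable H v"
  shows "claim p v (game_union G H) = game_union G (claim p v H)"
  using claim_union_left[OF disjoint_gamesD(3)[OF assms(1)] assms(2)]
  by (simp add: game_union_commute)

lemma maker_wins_union_Maker: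
  assumes "disjoint_games G H"
  shows "playable G v \<Longrightarrow> maker_wins (game_union (claim Maker v G) H) Breaker
      \<Longrightarrow> maker_wins (game_union G H) Maker"
    and "playable H v \<Longrightarrow> maker_wins (game_union G (claim Maker v H)) Breaker
      \<Longrightarrow> maker_wins (game_union G H) Maker"
proof -
  have claim: "maker_wins (game_union G H) Maker"
    if "playable (game_union G H) v" "maker_wins (claim Maker v (game_union G H)) Breaker" for v
    using that maker_wins_Maker[of "game_union G H"] playable_in_board[OF that(1)] by blast
  then show "playable G v \<Longrightarrow> maker_wins (game_union (claim Maker v G) H) Breaker
      \<Longrightarrow> maker_wins (game_union G H) Maker"
    and "playable H v \<Longrightarrow> maker_wins (game_union G (claim Maker v H)) Breaker
      \<Longrightarrow> maker_wins (game_union G H) Maker"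
    by (metis claim playable_union[OF assms] claim_union_left[OF assms])
      (metis claim playable_union[OF assms] claim_union_right[OF assms])
qed

lemma maker_wins_union_Breaker:
  assumes "disjoint_games G H" and "board G \<union> board H \<noteq> {}"
  shows "maker_wins (game_union G H) Breaker \<longleftrightarrow>
    (\<forall>v. playable G v \<longrightarrow> maker_wins (game_union (claim Breaker v G) H) Maker) \<and>
    (\<forall>v. playable H v \<longrightarrow> maker_wins (game_union G (claim Breaker v H)) Maker)"
  using maker_wins_Breaker[of "game_union G H"] assms(2) playable_union[OF assms(1)]
    claim_union_left[OF assms(1)] claim_union_right[OF assms(1)]
  by (auto simp del: Un_empty)

section \<open>Maker's strategies in a union\<close>

lemma exists_playable_odd: "poset_game G \<Longrightarrow> odd (card (board G)) \<Longrightarrow> \<exists>v. playable G v"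
  by (rule exists_playable) auto

lemma maker_wins_union_won:
  assumes "disjoint_games G H" and "{} \<in> winning_sets G \<union> winning_sets H"
  shows "maker_wins (game_union G H) s"
  by (rule maker_wins_if_won) (use assms in \<open>simp_all add: poset_game_union\<close>)

text \<open>On an empty board a win means that \<open>{}\<close> is a winning set. So when Maker is
  to move in a component of value win, either nothing remains to be done or a move there preserves
  the value.\<close>

lemma maker_wins_MakerE:
  assumes "maker_wins G Maker"
  obtains "{} \<in> winning_sets G" | v where "playable G v" "maker_wins (claim Maker v G) Breaker"
  using assms maker_wins_Maker maker_wins_empty_board by metis

lemma maker_wins_BreakerD:
  "maker_wins G Breaker \<Longrightarrow> playable G v \<Longrightarrow> maker_wins (claim Breaker v G) Maker"
  using maker_wins_Breaker playable_in_board by (metis empty_iff)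

lemma not_maker_wins_MakerD:
  "\<not> maker_wins G Maker \<Longrightarrow> playable G v \<Longrightarrow> \<not> maker_wins (claim Maker v G) Breaker"
  using maker_wins_Maker playable_in_board by (metis empty_iff)

text \<open>Maker follows her strategy in \<open>G\<close> and never opens \<open>H\<close>. A
  Breaker move in \<open>H\<close> leaves an odd number of vertices, so she can answer there
  arbitrarily and \<open>H\<close> is even again with the turn in \<open>G\<close> unchanged. If
  \<open>G\<close> is exhausted, she has already completed a set.\<close>

lemma maker_wins_union_even:
  assumes "disjoint_games G H" and "even (card (board H))" and "maker_wins G s"
  shows "maker_wins (game_union G H) s"
  using assms
proof (induction "card (board G) + card (board H)" arbitrary: G H s rule: less_induct)
  case less
  note dis = less.prems(1)
  note G = disjoint_gamesD(1)[OF dis] and H = disjoint_gamesD(2)[OF dis]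
  show ?case
  proof (cases "{} \<in> winning_sets G \<union> winning_sets H")
    case True
    then show ?thesis
      by (rule maker_wins_union_won[OF dis])
  next
    case not_won: False
    have in_G: "maker_wins (game_union (claim p v G) H) s'"
      if "playable G v" "maker_wins (claim p v G) s'" for p v s'
      using less.hyps[OF _ disjoint_games_claim(1)[OF dis] less.prems(2) that(2)]
        card_claim_less[OF G that(1)] by simp
    show ?thesis
    proof (cases s)
      case Maker
      then show ?thesis
        using less.prems(3) not_won in_G maker_wins_union_Maker(1)[OF dis]
        by (auto elim: maker_wins_MakerE)
    next
      case Breaker
      have in_H: "maker_wins (game_union G (claim Breaker v H)) Maker" if v: "playable H v" for v
      proof -
        let ?H = "claim Breaker v H"
        have H': "poset_game ?H" and dis': "disjoint_games G ?H"
          using H dis by (simp_all add: poset_game_claim disjoint_games_claim)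
        have "odd (card (board ?H))"
          using card_claim[OF H v, of Breaker] less.prems(2) by simp
        with H' obtain w where w: "playable ?H w"
          using exists_playable_odd by blast
        have "maker_wins (game_union G (claim Maker w ?H)) Breaker"
          using less.hyps[OF _ disjoint_games_claim(2)[OF dis'], of Maker w Breaker]
            card_claim[OF H v, of Breaker] card_claim[OF H' w, of Maker] less.prems Breaker
          by simp
        with w show ?thesis
          by (rule maker_wins_union_Maker(2)[OF dis'])
      qed
      have "board G \<union> board H \<noteq> {}"
        using less.prems(3) not_won maker_wins_empty_board[of G] by auto
      then show ?thesis
        using Breaker in_G in_H maker_wins_BreakerD[of G] less.prems(3)
        by (auto simp: maker_wins_union_Breaker[OF dis] simp del: Un_empty)
    qed
  qed
qed

text \<open>One move in \<open>H\<close> makes it even and turns Maker into the second player in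
  \<open>G\<close>.\<close>

lemma maker_wins_union_odd:
  assumes "disjoint_games G H" and "odd (card (board H))" and "maker_wins G Breaker"
  shows "maker_wins (game_union G H) Maker"
proof -
  note H = disjoint_gamesD(2)[OF assms(1)]
  obtain v where v: "playable H v"
    using exists_playable_odd[OF H assms(2)] by blast
  have "even (card (board (claim Maker v H)))"
    using assms(2) card_claim[OF H v, of Maker] by simp
  then have "maker_wins (game_union G (claim Maker v H)) Breaker"
    using maker_wins_union_even[OF disjoint_games_claim(2)[OF assms(1)] _ assms(3)] by blast
  with v show ?thesis
    by (rule maker_wins_union_Maker(2)[OF assms(1)])
qed

text \<open>Maker answers in the component where Breaker has just played; she is only prevented from doing
  so once that component is full, hence won by her.\<close>

lemma maker_wins_union_second:
  assumes "disjoint_games G H" and "maker_wins G Breaker" and "maker_wins H Breaker"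
  shows "maker_wins (game_union G H) Breaker"
  using assms
proof (induction "card (board G) + card (board H)" arbitrary: G H rule: less_induct)
  case less
  \<comment> \<open>Stated for fresh games, with the needed instance of the induction hypothesis as
    a premise, so that it covers Breaker's moves in either component by swapping their
    roles.\<close>
  have reply: "maker_wins (game_union (claim Breaker v G) H) Maker"
    if dis: "disjoint_games G H" and G: "maker_wins G Breaker" and H: "maker_wins H Breaker"
      and v: "playable G v"
      and IH: "\<And>G'. \<lbrakk>card (board G') < card (board G); disjoint_games G' H; maker_wins G' Breaker\<rbrakk>
        \<Longrightarrow> maker_wins (game_union G' H) Breaker"
    for G H :: "'a ppg" and v
  proof -
    have dis': "disjoint_games (claim Breaker v G) H"
      using dis by (rule disjoint_games_claim)
    note pg = disjoint_gamesD(1)[OF dis] disjoint_gamesD(1)[OF dis']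
    from maker_wins_BreakerD[OF G v] show ?thesis
    proof (cases rule: maker_wins_MakerE)
      case 1
      then show ?thesis
        using maker_wins_union_won[OF dis'] by blast
    next
      case (2 w)
      have "card (board (claim Maker w (claim Breaker v G))) < card (board G)"
        using card_claim_less[OF pg(1) v] card_claim_less[OF pg(2) 2(1)] by (rule less_trans[rotated])
      then have "maker_wins (game_union (claim Maker w (claim Breaker v G)) H) Breaker"
        using IH disjoint_games_claim(1)[OF dis'] 2(2) by blast
      with 2(1) show ?thesis
        by (rule maker_wins_union_Maker(1)[OF dis'])
    qed
  qed
  note dis = less.prems(1)
  show ?case
  proof (cases "board G \<union> board H = {}")
    case True
    then show ?thesis
      using less.prems maker_wins_union_won[OF dis] maker_wins_empty_board[of G] by auto
  next
    case False
    have "maker_wins (game_union (claim Breaker v G) H) Maker" if "playable G v" for v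
      by (rule reply[OF less.prems that]) (rule less.hyps; simp add: less.prems)
    moreover have "maker_wins (game_union (claim Breaker v H) G) Maker" if "playable H v" for v
    proof (rule reply[OF disjoint_gamesD(3)[OF dis] less.prems(3,2) that])
      fix H' assume H': "card (board H') < card (board H)" "disjoint_games H' G" "maker_wins H' Breaker"
      show "maker_wins (game_union H' G) Breaker"
        using less.hyps[OF _ disjoint_gamesD(3)[OF H'(2)] less.prems(2) H'(3)] H'(1)
        by (simp add: game_union_commute)
    qed
    ultimately show ?thesis
      using False by (simp add: maker_wins_union_Breaker[OF dis] game_union_commute del: Un_empty)
  qed
qed

text \<open>A winning opening in \<open>G\<close> leaves two components that Maker wins as second
  player; an opening is lacking only if \<open>G\<close> is already won.\<close>

lemma maker_wins_union_first:
  assumes dis: "disjoint_games G H" and "maker_wins G Maker" and "maker_wins H Breaker"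
  shows "maker_wins (game_union G H) Maker"
  using assms(2)
proof (cases rule: maker_wins_MakerE)
  case 1
  then show ?thesis
    using maker_wins_union_won[OF dis] by blast
next
  case (2 v)
  have "maker_wins (game_union (claim Maker v G) H) Breaker"
    using disjoint_games_claim(1)[OF dis] 2(2) assms(3) by (rule maker_wins_union_second)
  with 2(1) show ?thesis
    by (rule maker_wins_union_Maker(1)[OF dis])
qed

text \<open>Maker answers Breaker's first move by a winning first move in the other component.  The
  component touched by Breaker then has an even number of vertices left.\<close>

lemma maker_wins_union_odd_odd:
  assumes dis: "disjoint_games G H"
    and odd: "odd (card (board G))" "odd (card (board H))"
    and wins: "maker_wins G Maker" "maker_wins H Maker"
  shows "maker_wins (game_union G H) Breaker"
proof -
  have reply: "maker_wins (game_union (claim Breaker v G) H) Maker"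
    if dis: "disjoint_games G H" and odd: "odd (card (board G))" and H: "maker_wins H Maker"
      and v: "playable G v" for G H :: "'a ppg" and v
  proof -
    have dis': "disjoint_games (claim Breaker v G) H"
      using dis by (rule disjoint_games_claim)
    have ev: "even (card (board (claim Breaker v G)))"
      using odd card_claim[OF disjoint_gamesD(1)[OF dis] v, of Breaker] by simp
    from disjoint_gamesD(3)[OF dis'] ev H
    have "maker_wins (game_union H (claim Breaker v G)) Maker"
      by (rule maker_wins_union_even)
    then show ?thesis
      by (simp add: game_union_commute)
  qed
  have "board G \<union> board H \<noteq> {}"
    using odd(1) by auto
  then show ?thesis
    using reply[OF dis odd(1) wins(2)] reply[OF disjoint_gamesD(3)[OF dis] odd(2) wins(1)]
    by (simp add: maker_wins_union_Breaker[OF dis] game_union_commute del: Un_empty)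
qed

section \<open>Breaker's strategies in a union\<close>

text \<open>Breaker always answers in the component just touched, which has an odd number of
  vertices left, and his answer restores the hypotheses. Here parity cannot be replaced by the
  remark that a full component is already decided: a full component without a completed set does not
  stop Maker from winning in the other.\<close>

lemma not_maker_wins_union_even_even:
  assumes "disjoint_games G H"
    and "even (card (board G))" and "even (card (board H))"
    and "\<not> maker_wins G Maker" and "\<not> maker_wins H Maker"
  shows "\<not> maker_wins (game_union G H) Maker"
  using assms
proof (induction "card (board G) + card (board H)" arbitrary: G H rule: less_induct)
  case less
  have reply: "\<not> maker_wins (game_union (claim Maker v G) H) Breaker"
    if dis: "disjoint_games G H" and ev: "even (card (board G))" and G: "\<not> maker_wins G Maker"
      and v: "playable G v"
      and IH: "\<And>G'. \<lbrakk>card (board G') < card (board G); disjoint_games G' H; even (card (board G'));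
        \<not> maker_wins G' Maker\<rbrakk> \<Longrightarrow> \<not> maker_wins (game_union G' H) Maker"
    for G H :: "'a ppg" and v
  proof -
    let ?G = "claim Maker v G"
    have dis': "disjoint_games ?G H"
      using dis by (rule disjoint_games_claim)
    note pg = disjoint_gamesD(1)[OF dis] disjoint_gamesD(1)[OF dis']
    have "odd (card (board ?G))"
      using ev card_claim[OF pg(1) v, of Maker] by simp
    then have "board ?G \<noteq> {}"
      by (metis card.empty even_zero)
    then obtain w where w: "playable ?G w" "\<not> maker_wins (claim Breaker w ?G) Maker"
      using not_maker_wins_MakerD[OF G v] maker_wins_Breaker[of ?G] by blast
    have "\<not> maker_wins (game_union (claim Breaker w ?G) H) Maker"
      by (rule IH) (use card_claim[OF pg(1) v, of Maker] card_claim[OF pg(2) w(1), of Breaker] ev w(2)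
          disjoint_games_claim(1)[OF dis'] in simp_all)
    then show ?thesis
      using w(1) maker_wins_union_Breaker[OF dis'] playable_in_board[of ?G w] by blast
  qed
  note dis = less.prems(1)
  have "\<not> maker_wins (game_union (claim Maker v G) H) Breaker" if "playable G v" for v
    by (rule reply[OF dis less.prems(2,4) that]) (rule less.hyps; simp add: less.prems)
  moreover have "\<not> maker_wins (game_union G (claim Maker v H)) Breaker" if "playable H v" for v
  proof (subst game_union_commute, rule reply[OF disjoint_gamesD(3)[OF dis] less.prems(3,5) that])
    fix H' assume H': "card (board H') < card (board H)" "disjoint_games H' G"
      "even (card (board H'))" "\<not> maker_wins H' Maker"
    show "\<not> maker_wins (game_union H' G) Maker"
      using less.hyps[OF _ disjoint_gamesD(3)[OF H'(2)] less.prems(2) H'(3) less.prems(4) H'(4)] H'(1)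
      by (simp add: game_union_commute)
  qed
  moreover have "{} \<notin> winning_sets G \<union> winning_sets H"
    using less.prems disjoint_gamesD[OF dis] maker_wins_if_won by blast
  \<comment> \<open>A win of Maker needs a winning opening in one of the components; the first
    disjunct accounts for two empty boards. The three preceding facts exclude every
    alternative.\<close>
  moreover have "{} \<in> winning_sets G \<union> winning_sets H \<or>
      (\<exists>v. playable G v \<and> maker_wins (game_union (claim Maker v G) H) Breaker) \<or>
      (\<exists>v. playable H v \<and> maker_wins (game_union G (claim Maker v H)) Breaker)"
    if "maker_wins (game_union G H) Maker"
    using that
  proof (cases rule: maker_wins_MakerE)
    case (2 v)
    then show ?thesis
      using playable_union[OF dis, of v] claim_union_left[OF dis, of v] claim_union_right[OF dis, of v]
      by metis
  qed simp
  ultimately show ?case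
    by blast
qed

text \<open>Breaker opens with his winning move in \<open>H\<close>. Both components are then even,
  Maker is to move, and she wins neither of them as first player.\<close>

lemma not_maker_wins_union_even_odd:
  assumes dis: "disjoint_games G H"
    and "even (card (board G))" and odd: "odd (card (board H))"
    and "\<not> maker_wins G Maker" and "\<not> maker_wins H Breaker"
  shows "\<not> maker_wins (game_union G H) Breaker"
proof -
  have "board H \<noteq> {}"
    using odd by auto
  with assms(5) obtain v where v: "playable H v" "\<not> maker_wins (claim Breaker v H) Maker"
    using maker_wins_Breaker[of H] by blast
  have "even (card (board (claim Breaker v H)))"
    using odd card_claim[OF disjoint_gamesD(2)[OF dis] v(1), of Breaker] by simp
  then have "\<not> maker_wins (game_union G (claim Breaker v H)) Maker"
    using not_maker_wins_union_even_even[OF disjoint_games_claim(2)[OF dis]] assms v(2) by blast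
  then show ?thesis
    using v(1) maker_wins_union_Breaker[OF dis] \<open>board H \<noteq> {}\<close> by blast
qed

subsection \<open>Games given by lists\<close>

text \<open>Each vertex is listed with the vertices strictly below it; the second component lists the
  winning sets.\<close>

type_synonym 'v code = "('v \<times> 'v list) list \<times> 'v list list"

fun game_of :: "('v \<Rightarrow> 'a) \<Rightarrow> 'v code \<Rightarrow> 'a ppg" where
  "game_of f (R, Ws) =
    \<lparr>board = f ` fst ` set R,
     winning_sets = (\<lambda>W. f ` set W) ` set Ws,
     order = {(f u, f v) | u v us. (v, us) \<in> set R \<and> u \<in> set (v # us)}\<rparr>"

text \<open>The numerical condition \<open>u < v\<close> makes the labels a linear extension, an
  easily evaluated guarantee of antisymmetry. The clause on \<open>ts\<close> is transitivity: the
  predecessor lists must be complete, not just cover relations.\<close>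

fun valid_code :: "nat code \<Rightarrow> bool" where
  "valid_code (R, Ws) \<longleftrightarrow> distinct (map fst R) \<and>
    (\<forall>(v, us) \<in> set R. (\<forall>u \<in> set us. u < v \<and> u \<in> set (map fst R)) \<and>
       (\<forall>(w, ts) \<in> set R. w \<in> set us \<longrightarrow> set ts \<subseteq> set us)) \<and>
    (\<forall>W \<in> set Ws. set W \<subseteq> set (map fst R))"

text \<open>Purging \<open>v\<close> from the remaining predecessor lists keeps an empty list as the
  test for being playable.\<close>

definition delete_vertex :: "'v \<Rightarrow> ('v \<times> 'v list) list \<Rightarrow> ('v \<times> 'v list) list" where
  "delete_vertex v R = map (apsnd (removeAll v)) (filter (\<lambda>r. fst r \<noteq> v) R)"

primrec some_minimal :: "('v \<Rightarrow> bool) \<Rightarrow> ('v \<times> 'v list) list \<Rightarrow> bool" where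
  "some_minimal P [] \<longleftrightarrow> False"
| "some_minimal P (r # R) \<longleftrightarrow> snd r = [] \<and> P (fst r) \<or> some_minimal P R"

primrec all_minimal :: "('v \<Rightarrow> bool) \<Rightarrow> ('v \<times> 'v list) list \<Rightarrow> bool" where
  "all_minimal P [] \<longleftrightarrow> True"
| "all_minimal P (r # R) \<longleftrightarrow> (snd r \<noteq> [] \<or> P (fst r)) \<and> all_minimal P R"

fun claim_code :: "player \<Rightarrow> 'v \<Rightarrow> 'v code \<Rightarrow> 'v code" where
  "claim_code Maker v (R, Ws) = (delete_vertex v R, map (removeAll v) Ws)"
| "claim_code Breaker v (R, Ws) = (delete_vertex v R, filter (\<lambda>W. v \<notin> set W) Ws)"

definition after_claim :: "('v code \<Rightarrow> player \<Rightarrow> bool) \<Rightarrow> player \<Rightarrow> 'v code \<Rightarrow> 'v \<Rightarrow> bool" where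
  "after_claim K s c v \<longleftrightarrow> K (claim_code s v c) (opponent s)"

text \<open>The continuation \<open>wins_code n\<close> is passed as a partial application so that the code simplifier
  does not unfold it before the claimed vertex is known.\<close>

primrec wins_code :: "nat \<Rightarrow> 'v code \<Rightarrow> player \<Rightarrow> bool" where
  "wins_code 0 c s \<longleftrightarrow> [] \<in> set (snd c)"
| "wins_code (Suc n) c s \<longleftrightarrow> snd c \<noteq> [] \<and> ([] \<in> set (snd c) \<or>
     (case s of
        Maker \<Rightarrow> some_minimal (after_claim (wins_code n) Maker c) (fst c)
      | Breaker \<Rightarrow> all_minimal (after_claim (wins_code n) Breaker c) (fst c)))"

definition outcome_code :: "'v code \<Rightarrow> outcome" where
  "outcome_code c = (let n = length (fst c) in
    if wins_code n c Maker then if wins_code n c Breaker then \<M> else \<N>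
    else if wins_code n c Breaker then \<P> else \<B>)"

definition parity_code :: "'v code \<Rightarrow> parity" where
  "parity_code c = (if even (length (fst c)) then Even else Odd)"

fun map_code :: "('v \<Rightarrow> 'w) \<Rightarrow> 'v code \<Rightarrow> 'w code" where
  "map_code g (R, Ws) = (map (map_prod g (map g)) R, map (map g) Ws)"

fun union_code :: "'v code \<Rightarrow> 'v code \<Rightarrow> 'v code" where
  "union_code (R, Ws) (R', Ws') = (R @ R', Ws @ Ws')"

definition sum_code :: "'v code \<Rightarrow> 'w code \<Rightarrow> ('v + 'w) code" where
  "sum_code c d = union_code (map_code Inl c) (map_code Inr d)"

subsection \<open>Correctness of the codes\<close>

text \<open>The part of \<open>valid_code\<close> that makes sense for labels of any type, in
  particular for those of \<open>sum_code\<close>. It makes the length count the vertices and keeps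
  a vertex from blocking itself; the order axioms are carried separately by
  \<open>poset_game\<close>.\<close>

definition irredundant :: "('v \<times> 'v list) list \<Rightarrow> bool" where
  "irredundant R \<longleftrightarrow> distinct (map fst R) \<and> (\<forall>(v, us) \<in> set R. v \<notin> set us)"

lemma some_minimal_iff: "some_minimal P R \<longleftrightarrow> (\<exists>v. (v, []) \<in> set R \<and> P v)"
  by (induction R) auto

lemma all_minimal_iff: "all_minimal P R \<longleftrightarrow> (\<forall>v. (v, []) \<in> set R \<longrightarrow> P v)"
  by (induction R) auto

lemma set_delete_vertex:
  "set (delete_vertex v R) = {(w, removeAll v us) | w us. (w, us) \<in> set R \<and> w \<noteq> v}"
  by (force simp: delete_vertex_def)

lemma map_fst_delete_vertex: "map fst (delete_vertex v R) = removeAll v (map fst R)"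
  by (induction R) (auto simp: delete_vertex_def)

lemma irredundant_delete_vertex: "irredundant R \<Longrightarrow> irredundant (delete_vertex v R)"
  by (auto simp: irredundant_def map_fst_delete_vertex distinct_removeAll set_delete_vertex)

lemma length_delete_vertex:
  assumes "irredundant R" and "(v, us) \<in> set R"
  shows "length R = Suc (length (delete_vertex v R))"
proof -
  have v: "v \<in> set (map fst R)"
    using assms(2) by force
  have "length (delete_vertex v R) = length (remove1 v (map fst R))"
    using assms(1) map_fst_delete_vertex[of v R]
    by (metis distinct_remove1_removeAll irredundant_def length_map)
  then show ?thesis
    using v length_pos_if_in_set[OF v] by (simp add: length_remove1)
qed

lemma fst_claim_code: "fst (claim_code p v c) = delete_vertex v (fst c)"
  by (cases p; cases c) simp_all

lemma game_of_claim:
  assumes "inj f"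
  shows "claim p (f v) (game_of f c) = game_of f (claim_code p v c)"
proof (cases c)
  case (Pair R Ws)
  have b: "f ` fst ` set R - {f v} = f ` fst ` set (delete_vertex v R)"
    using assms by (force simp: set_delete_vertex inj_eq)
  have o: "{(x, y) \<in> order (game_of f (R, Ws)). x \<noteq> f v \<and> y \<noteq> f v} =
      order (game_of f (delete_vertex v R, Ws'))" for Ws'
    using assms by (fastforce simp: set_delete_vertex inj_eq)
  have "(\<lambda>W. W - {f v}) ` (\<lambda>W. f ` set W) ` set Ws = (\<lambda>W. f ` set W) ` set (map (removeAll v) Ws)"
    using image_set_diff[OF assms, of _ "{v}"] by (simp add: image_image)
  moreover have "{W \<in> (\<lambda>W. f ` set W) ` set Ws. f v \<notin> W} =
      (\<lambda>W. f ` set W) ` set (filter (\<lambda>W. v \<notin> set W) Ws)"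
    using inj_image_mem_iff[OF assms] by (auto simp del: image_iff)
  ultimately show ?thesis
    using b o Pair by (cases p) (simp_all add: claim_def)
qed

lemma playable_game_of:
  assumes "inj f" and "irredundant (fst c)"
  shows "playable (game_of f c) x \<longleftrightarrow> (\<exists>v. x = f v \<and> (v, []) \<in> set (fst c))"
proof (cases c)
  case (Pair R Ws)
  have R: "distinct (map fst R)" "\<And>v us. (v, us) \<in> set R \<Longrightarrow> v \<notin> set us"
    using assms(2) Pair by (auto simp: irredundant_def)
  show ?thesis
  proof
    assume x: "playable (game_of f c) x"
    then obtain v us where v: "x = f v" "(v, us) \<in> set R"
      using Pair by (auto simp: available_def)
    have "u = v" if "u \<in> set us" for u
      using x v that Pair assms(1) by (fastforce simp: available_def inj_eq)
    then have "us = []"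
      using R(2)[OF v(2)] by (metis list.set_intros(1) neq_Nil_conv)
    then show "\<exists>v. x = f v \<and> (v, []) \<in> set (fst c)"
      using v Pair by auto
  next
    assume "\<exists>v. x = f v \<and> (v, []) \<in> set (fst c)"
    then obtain v where v: "x = f v" "(v, []) \<in> set R"
      using Pair by auto
    have "us = []" if "(v, us) \<in> set R" for us
      using eq_key_imp_eq_value[OF R(1) that v(2)] .
    then show "playable (game_of f c) x"
      using v Pair assms(1) by (force simp: available_def inj_eq)
  qed
qed

text \<open>The fuel equals the number of unclaimed vertices: labels are distinct, so each deletion
  lowers the length by exactly one and the fuel is \<open>0\<close> just when the board is
  empty.\<close>

lemma wins_code_iff:
  assumes "inj f" and "poset_game (game_of f c)" and "irredundant (fst c)"
  shows "wins_code (length (fst c)) c s \<longleftrightarrow> maker_wins (game_of f c) s"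
  using assms(2,3)
proof (induction "length (fst c)" arbitrary: c s)
  case 0
  then have "board (game_of f c) = {}"
    by (cases c) simp
  then show ?case
    using 0 by (cases c) (auto simp: maker_wins_empty_board)
next
  case (Suc n)
  note n = Suc.hyps(2)
  have board: "board (game_of f c) \<noteq> {}"
    using n by (cases c) auto
  have lost: "snd c = [] \<longleftrightarrow> winning_sets (game_of f c) = {}"
    and won: "[] \<in> set (snd c) \<longleftrightarrow> {} \<in> winning_sets (game_of f c)"
    by (cases c; auto)+
  have IH: "wins_code n (claim_code p v c) s' \<longleftrightarrow> maker_wins (claim p (f v) (game_of f c)) s'"
    if "(v, []) \<in> set (fst c)" for p v s'
  proof -
    have "n = length (fst (claim_code p v c))"
      using n length_delete_vertex[OF Suc.prems(2) that] by (simp add: fst_claim_code)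
    moreover have "poset_game (game_of f (claim_code p v c))"
      using poset_game_claim[OF Suc.prems(1)] by (simp add: game_of_claim[OF assms(1), symmetric])
    moreover have "irredundant (fst (claim_code p v c))"
      using irredundant_delete_vertex[OF Suc.prems(2)] by (simp add: fst_claim_code)
    ultimately show ?thesis
      using Suc.hyps(1) by (simp add: game_of_claim[OF assms(1)])
  qed
  have "(case s of
        Maker \<Rightarrow> some_minimal (after_claim (wins_code n) Maker c) (fst c)
      | Breaker \<Rightarrow> all_minimal (after_claim (wins_code n) Breaker c) (fst c))
      \<longleftrightarrow> maker_wins (game_of f c) s"
    using IH playable_game_of[OF assms(1) Suc.prems(2)]
    by (cases s)
      (auto simp: some_minimal_iff all_minimal_iff after_claim_def
        maker_wins_Maker[OF board] maker_wins_Breaker[OF board])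
  then show ?case
    \<comment> \<open>The two early exits of \<open>wins_code\<close> are sound because a completed
      set decides the game for Maker and an empty family decides it for Breaker.\<close>
    unfolding n[symmetric] wins_code.simps lost won
    using maker_wins_if_won[OF Suc.prems(1)] not_maker_wins_if_lost[OF Suc.prems(1)] by blast
qed

lemma outcome_of_game_of:
  assumes "inj f" and "poset_game (game_of f c)" and "irredundant (fst c)"
  shows "outcome_of (game_of f c) = outcome_code c"
  unfolding outcome_code_def Let_def wins_code_iff[OF assms] outcome_of_eq[OF assms(2)] ..

lemma parity_of_game_of:
  assumes "inj f" and "irredundant (fst c)"
  shows "parity_of (game_of f c) = parity_code c"
proof (cases c)
  case (Pair R Ws)
  have "card (board (game_of f c)) = card (fst ` set R)"
    using assms(1) Pair by (simp add: card_image inj_on_subset)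
  also have "\<dots> = length R"
    using assms(2) Pair distinct_card[of "map fst R"] by (simp add: irredundant_def)
  finally show ?thesis
    using Pair by (simp add: parity_of_def parity_code_def)
qed

lemma game_of_map_code: "game_of f (map_code g c) = game_of (f \<circ> g) c"
proof (cases c)
  case (Pair R Ws)
  have "order (game_of f (map_code g c)) = order (game_of (f \<circ> g) c)"
    unfolding Pair by (auto simp: image_iff) (force | blast)+
  then show ?thesis
    using Pair by (simp add: image_image)
qed

lemma game_of_union_code:
  "game_of f (union_code c d) = game_union (game_of f c) (game_of f d)"
proof -
  have "order (game_of f (union_code c d)) = order (game_of f c) \<union> order (game_of f d)"
    by (cases c; cases d) fastforce
  then show ?thesis
    by (cases c; cases d) (simp add: game_union_def image_Un)
qed

lemma game_of_sum_code:
  "game_of f (sum_code c d) = game_union (game_of (f \<circ> Inl) c) (game_of (f \<circ> Inr) d)"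
  by (simp add: sum_code_def game_of_union_code game_of_map_code)

lemma irredundant_sum_code:
  assumes "irredundant (fst c)" and "irredundant (fst d)"
  shows "irredundant (fst (sum_code c d))"
proof -
  obtain R Ws R' Ws' where c: "c = (R, Ws)" and d: "d = (R', Ws')"
    by (metis surj_pair)
  have "map fst (fst (sum_code c d)) = map Inl (map fst R) @ map Inr (map fst R')"
    by (simp add: c d sum_code_def)
  moreover have "distinct (map Inl (map fst R) @ map Inr (map fst R'))"
    using assms by (auto simp: c d irredundant_def distinct_map[of Inl] distinct_map[of Inr] simp del: map_map)
  moreover have "\<forall>(v, us) \<in> set (fst (sum_code c d)). v \<notin> set us"
    using assms by (auto simp: c d sum_code_def irredundant_def)
  ultimately show ?thesis
    by (simp add: irredundant_def)
qed

lemma board_game_of: "board (game_of f c) = f ` fst ` set (fst c)"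
  by (cases c) simp

lemma valid_code_irredundant: "valid_code c \<Longrightarrow> irredundant (fst c)"
  by (cases c) (auto simp: irredundant_def)

lemma partial_order_on_image:
  assumes "inj f" and "partial_order_on A r"
  shows "partial_order_on (f ` A) (map_prod f f ` r)"
proof -
  note r = partial_order_onD[OF assms(2)]
  have "map_prod f f ` r \<subseteq> f ` A \<times> f ` A"
    using r(4) by auto
  moreover have "refl_on (f ` A) (map_prod f f ` r)"
    using r(1) by (force simp: refl_on_def)
  moreover have "trans (map_prod f f ` r)"
  proof (rule transI)
    fix x y z assume "(x, y) \<in> map_prod f f ` r" "(y, z) \<in> map_prod f f ` r"
    then obtain a b c where "x = f a" "z = f c" "(a, b) \<in> r" "(b, c) \<in> r"
      by (auto simp: inj_eq[OF assms(1)])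
    then show "(x, z) \<in> map_prod f f ` r"
      using transD[OF r(2)] by force
  qed
  moreover have "antisym (map_prod f f ` r)"
  proof (rule antisymI)
    fix x y assume "(x, y) \<in> map_prod f f ` r" "(y, x) \<in> map_prod f f ` r"
    then obtain a b where "x = f a" "y = f b" "(a, b) \<in> r" "(b, a) \<in> r"
      by (auto simp: inj_eq[OF assms(1)])
    then show "x = y"
      using antisymD[OF r(3)] by blast
  qed
  ultimately show ?thesis
    by (simp add: order_on_defs)
qed

lemma poset_game_of:
  assumes "inj f" and "valid_code c"
  shows "poset_game (game_of f c)"
proof (cases c)
  case (Pair R Ws)
  let ?r = "{(u, v) | u v us. (v, us) \<in> set R \<and> u \<in> set (v # us)}"
  have R: "distinct (map fst R)"
    "\<And>u v us. (v, us) \<in> set R \<Longrightarrow> u \<in> set us \<Longrightarrow> u < v \<and> u \<in> fst ` set R"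
    "\<And>v us w ts. (v, us) \<in> set R \<Longrightarrow> (w, ts) \<in> set R \<Longrightarrow> w \<in> set us \<Longrightarrow> set ts \<subseteq> set us"
    and Ws: "\<And>W. W \<in> set Ws \<Longrightarrow> set W \<subseteq> fst ` set R"
    using assms(2) Pair by (simp_all, blast+)
  have order: "order (game_of f c) = map_prod f f ` ?r"
    unfolding Pair by force
  have less: "u = v \<or> u < v" if "(u, v) \<in> ?r" for u v
    using that R(2) by auto
  have "?r \<subseteq> fst ` set R \<times> fst ` set R"
    using R(2) by force
  moreover have "refl_on (fst ` set R) ?r"
    by (force simp: refl_on_def)
  moreover have "trans ?r"
    using R(3) by (intro transI) fastforce
  moreover have "antisym ?r"
  proof (rule antisymI)
    fix u v assume "(u, v) \<in> ?r" "(v, u) \<in> ?r"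
    from this[THEN less] show "u = v"
      by auto
  qed
  ultimately have "partial_order_on (fst ` set R) ?r"
    by (simp only: order_on_defs simp_thms)
  then have "partial_order_on (board (game_of f c)) (order (game_of f c))"
    unfolding order board_game_of using partial_order_on_image[OF assms(1)] Pair by simp
  moreover have "winning_sets (game_of f c) \<subseteq> Pow (board (game_of f c))"
    unfolding Pair game_of.simps ppg.select_convs by (intro image_subsetI PowI image_mono Ws)
  moreover have "finite (board (game_of f c))"
    by (simp add: board_game_of)
  ultimately show ?thesis
    by (simp only: poset_game_def simp_thms)
qed

subsection \<open>Compatible outcomes\<close>

definition maker_wins_first :: "outcome \<Rightarrow> bool" where
  "maker_wins_first c \<longleftrightarrow> c = \<M> \<or> c = \<N>"

definition maker_wins_second :: "outcome \<Rightarrow> bool" where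
  "maker_wins_second c \<longleftrightarrow> c = \<M> \<or> c = \<P>"

text \<open>Here \<open>e\<close> is the outcome of the union. The first two clauses are
  \<open>maker_wins_union_even\<close> for the two possible starters; each other clause is one
  further lemma on unions, in the order of their proofs. Several of them treat the components
  differently, so \<open>compatible\<close> imposes them in both orientations.\<close>

definition half_compatible :: "parity \<Rightarrow> outcome \<Rightarrow> parity \<Rightarrow> outcome \<Rightarrow> outcome \<Rightarrow> bool" where
  "half_compatible p c q d e \<longleftrightarrow>
     (q = Even \<and> maker_wins_first c \<longrightarrow> maker_wins_first e) \<and>
     (q = Even \<and> maker_wins_second c \<longrightarrow> maker_wins_second e) \<and>
     (q = Odd \<and> maker_wins_second c \<longrightarrow> maker_wins_first e) \<and>
     (maker_wins_second c \<and> maker_wins_second d \<longrightarrow> maker_wins_second e) \<and>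
     (maker_wins_first c \<and> maker_wins_second d \<longrightarrow> maker_wins_first e) \<and>
     (p = Odd \<and> q = Odd \<and> maker_wins_first c \<and> maker_wins_first d \<longrightarrow> maker_wins_second e) \<and>
     (p = Even \<and> q = Even \<and> \<not> maker_wins_first c \<and> \<not> maker_wins_first d \<longrightarrow>
        \<not> maker_wins_first e) \<and>
     (p = Even \<and> q = Odd \<and> \<not> maker_wins_first c \<and> \<not> maker_wins_second d \<longrightarrow>
        \<not> maker_wins_second e)"

definition compatible :: "parity \<Rightarrow> outcome \<Rightarrow> parity \<Rightarrow> outcome \<Rightarrow> outcome \<Rightarrow> bool" where
  "compatible p c q d e \<longleftrightarrow> half_compatible p c q d e \<and> half_compatible q d p c e"

lemma maker_wins_first_outcome_of:
  "poset_game G \<Longrightarrow> maker_wins_first (outcome_of G) \<longleftrightarrow> maker_wins G Maker"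
  by (simp add: maker_wins_first_def outcome_of_eq)

lemma maker_wins_second_outcome_of:
  "poset_game G \<Longrightarrow> maker_wins_second (outcome_of G) \<longleftrightarrow> maker_wins G Breaker"
  by (simp add: maker_wins_second_def outcome_of_eq)

lemma half_compatible_union:
  assumes "disjoint_games G H"
  shows "half_compatible (parity_of G) (outcome_of G) (parity_of H) (outcome_of H)
    (outcome_of (game_union G H))"
  unfolding half_compatible_def
    maker_wins_first_outcome_of[OF disjoint_gamesD(1)[OF assms]]
    maker_wins_first_outcome_of[OF disjoint_gamesD(2)[OF assms]]
    maker_wins_first_outcome_of[OF poset_game_union[OF assms]]
    maker_wins_second_outcome_of[OF disjoint_gamesD(1)[OF assms]]
    maker_wins_second_outcome_of[OF disjoint_gamesD(2)[OF assms]]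
    maker_wins_second_outcome_of[OF poset_game_union[OF assms]]
  using maker_wins_union_even[OF assms] maker_wins_union_odd[OF assms]
    maker_wins_union_second[OF assms] maker_wins_union_first[OF assms]
    maker_wins_union_odd_odd[OF assms]
    not_maker_wins_union_even_even[OF assms] not_maker_wins_union_even_odd[OF assms]
  by (simp add: parity_of_def)

lemma compatible_union:
  assumes "disjoint_games G H"
  shows "compatible (parity_of G) (outcome_of G) (parity_of H) (outcome_of H)
    (outcome_of (game_union G H))"
  using half_compatible_union[OF assms] half_compatible_union[OF disjoint_gamesD(3)[OF assms]]
  by (simp add: compatible_def game_union_commute)

lemma compatible_commute: "compatible p c q d e \<longleftrightarrow> compatible q d p c e"
  by (auto simp: compatible_def)

lemma union_outcomes_commute:
  fixes T :: "'a itself"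
  shows "union_outcomes T p c q d = union_outcomes T q d p c"
proof -
  have "union_outcomes T p c q d \<subseteq> union_outcomes T q d p c" for p c q d
  proof
    fix e assume "e \<in> union_outcomes T p c q d"
    then obtain G H :: "'a ppg" where "e = outcome_of (game_union H G)" "poset_game G" "poset_game H"
      "board H \<inter> board G = {}" "parity_of G = p" "outcome_of G = c" "parity_of H = q" "outcome_of H = d"
      unfolding union_outcomes_def by (auto simp: game_union_commute Int_commute)
    then show "e \<in> union_outcomes T q d p c"
      unfolding union_outcomes_def by blast
  qed
  then show ?thesis
    by blast
qed

subsection \<open>Examples\<close>

text \<open>All boards are chains, so every move is forced and the starter determines who gets which
  vertex. The family \<open>[[]]\<close> is won at the outset, the family \<open>[]\<close> is
  lost.\<close>

fun simple_code :: "parity \<times> outcome \<Rightarrow> nat code" where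
  "simple_code (Even, \<M>) = ([], [[]])"
| "simple_code (Even, \<N>) = ([(0, []), (1, [0])], [[0]])"
| "simple_code (Even, \<P>) = ([(0, []), (1, [0])], [[1]])"
| "simple_code (Even, \<B>) = ([], [])"
| "simple_code (Odd, \<M>) = ([(0, [])], [[]])"
| "simple_code (Odd, \<N>) = ([(0, [])], [[0]])"
| "simple_code (Odd, \<P>) = ([(0, []), (1, [0]), (2, [0, 1])], [[1]])"
| "simple_code (Odd, \<B>) = ([(0, [])], [])"

definition kinds :: "(parity \<times> outcome) list" where
  "kinds = List.product [Even, Odd] [\<M>, \<N>, \<P>, \<B>]"

text \<open>The games listed explicitly were found by computer search; the order of the vertices keeps
  the evaluated game trees small.\<close>

definition examples :: "(nat code \<times> nat code) list" where
  "examples = List.product (map simple_code kinds) (map simple_code kinds) @ [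
    (([(1, [0]), (0, [])], [[0]]),
     ([(3, [0, 2]), (2, [0]), (1, []), (0, [])], [[2]])),
    (([(0, []), (1, [])], [[0]]),
     ([(1, []), (2, [0]), (3, [0, 1, 2]), (0, [])], [[1, 3], [0, 2, 3]])),
    (([(3, [0, 1, 2]), (1, []), (0, []), (2, [0])], [[1, 3], [2, 3]]),
     ([(1, []), (2, [0]), (3, [0, 2]), (0, [])], [[1, 3]])),
    (([(3, [0, 2]), (0, []), (1, []), (2, [0])], [[0, 2], [0, 3], [1, 3], [2, 3]]),
     ([(2, [0]), (1, []), (0, [])], [[2]])),
    (([(3, [0, 2]), (0, []), (1, []), (2, [0])], [[0, 1], [0, 2], [3]]),
     ([(0, [])], [])),
    (([(0, []), (1, [0])], [[0]]),
     ([(0, []), (1, [0]), (2, [0, 1])], [[2]])),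
    (([(2, [0]), (3, [0, 1, 2]), (1, []), (0, [])], [[2], [1, 3]]),
     ([(0, [])], [])),
    (([(2, [0]), (1, []), (3, [0, 2]), (0, [])], [[2]]),
     ([(0, [])], [])),
    (([(3, [0, 1, 2]), (2, [0]), (1, []), (0, [])], [[1, 2], [2, 3]]),
     ([(0, [])], [])),
    (([(0, []), (1, []), (2, [0, 1]), (3, [0, 1, 2])], [[0, 3], [2, 3]]),
     ([(0, []), (1, [0]), (2, [0])], [[1]])),
    (([(3, [0]), (1, []), (2, []), (0, [])], [[0, 1, 2], [0, 3], [1, 3]]),
     ([(0, [])], [])),
    (([(3, []), (1, [0]), (4, []), (2, [0]), (0, [])], [[3], [1]]),
     ([(0, [])], [])),
    (([(0, []), (1, []), (2, [0, 1])], [[2]]),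
     ([(0, []), (1, []), (2, [0, 1])], [[2]])),
    (([(0, []), (1, []), (2, [0, 1])], [[0, 1], [2]]),
     ([(0, []), (1, [0]), (2, [0, 1])], [[1]])),
    (([(0, []), (1, []), (2, [0, 1])], [[0], [2]]),
     ([(0, [])], [])),
    (([(2, [0]), (1, []), (0, [])], [[2]]),
     ([(0, [])], [])),
    (([(0, []), (1, []), (2, [0, 1])], [[0, 2], [1, 2]]),
     ([(0, [])], [])),
    (([(2, [0, 1]), (1, [0]), (0, [])], [[1]]),
     ([(2, [1]), (4, [0]), (3, [0]), (1, []), (0, [])], [[2, 4]])),
    (([(3, [0]), (4, [0]), (2, [1]), (1, []), (0, [])], [[1, 4], [2, 3]]),
     ([(0, []), (1, [0]), (4, [0, 1, 2, 3]), (2, [0, 1]), (3, [0, 1])], [[1, 4], [0, 1, 2]])),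
    (([(2, []), (4, [1]), (0, []), (3, [1]), (1, [])], [[2, 4]]),
     ([(0, [])], [])),
    (([(1, [0]), (0, []), (4, [0, 1, 2]), (3, [0]), (2, [0, 1])], [[1, 3], [1, 4], [0, 2, 4]]),
     ([(1, [0]), (4, [0, 1, 2]), (3, [0]), (0, []), (2, [0, 1])], [[1, 3], [1, 4], [0, 2, 4]]))
   ]"

section \<open>Evaluation of the examples\<close>

definition kind_of_code :: "'v code \<Rightarrow> parity \<times> outcome" where
  "kind_of_code c = (parity_code c, outcome_code c)"

fun classify :: "nat code \<times> nat code \<Rightarrow> (parity \<times> outcome) \<times> (parity \<times> outcome) \<times> outcome" where
  "classify (c, d) = (kind_of_code c, kind_of_code d, outcome_code (sum_code c d))"

fun realized ::
  "((parity \<times> outcome) \<times> (parity \<times> outcome) \<times> outcome) list \<Rightarrow>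
    (parity \<times> outcome) \<times> (parity \<times> outcome) \<times> outcome \<Rightarrow> bool" where
  "realized ts ((p, c), (q, d), e) \<longleftrightarrow> (compatible p c q d e \<longrightarrow>
     ((p, c), (q, d), e) \<in> set ts \<or> ((q, d), (p, c), e) \<in> set ts)"

text \<open>Up to symmetry there are 36 pairs of classes and 57 permitted combinations of a pair
  with an outcome. Pairs of chains supply one outcome for each pair of classes, and each of the 21
  explicit pairs supplies one of the remaining combinations. Accepting either orientation in
  \<open>realized\<close> makes one listing per combination enough.\<close>

lemma compatible_realized:
  "list_all (realized (map classify examples))
    (List.product kinds (List.product kinds [\<M>, \<N>, \<P>, \<B>]))"
  by code_simp

lemma valid_examples: "list_all (\<lambda>(c, d). valid_code c \<and> valid_code d) examples"
  by code_simp

lemma example_union_outcome: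
  assumes "infinite (UNIV :: 'a set)" and "(c, d) \<in> set examples"
  shows "outcome_code (sum_code c d) \<in>
    union_outcomes TYPE('a) (parity_code c) (outcome_code c) (parity_code d) (outcome_code d)"
proof -
  obtain g :: "nat \<Rightarrow> 'a" where "inj g"
    using infinite_countable_subset[OF assms(1)] by blast
  then have f: "inj (g \<circ> sum_encode)"
    by (simp add: inj_compose inj_sum_encode)
  \<comment> \<open>\<open>sum_encode\<close> is the bijection from \<open>nat + nat\<close> to
    \<open>nat\<close>, so \<open>?f\<close> embeds the tagged labels of \<open>sum_code\<close>
    into the infinite vertex type; its restrictions along \<open>Inl\<close> and \<open>Inr\<close>
    put the two components on disjoint boards.\<close>
  let ?f = "g \<circ> sum_encode"
  have fl: "inj (?f \<circ> Inl)" and fr: "inj (?f \<circ> Inr)"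
    using f by (auto intro!: inj_compose)
  have valid: "valid_code c" "valid_code d"
    using valid_examples assms(2) by (auto simp: list_all_iff)
  note irr = valid[THEN valid_code_irredundant]
  let ?G = "game_of (?f \<circ> Inl) c" and ?H = "game_of (?f \<circ> Inr) d"
  have pg: "poset_game ?G" "poset_game ?H"
    using fl fr valid by (blast intro: poset_game_of)+
  have dis: "board ?G \<inter> board ?H = {}"
    using f by (auto simp: board_game_of inj_eq simp del: o_apply) (auto simp: inj_def)
  have "poset_game (game_union ?G ?H)"
    using pg dis by (simp add: poset_game_union disjoint_games_def)
  then have "outcome_of (game_union ?G ?H) = outcome_code (sum_code c d)"
    using outcome_of_game_of[OF f _ irredundant_sum_code[OF irr]] by (simp only: game_of_sum_code)
  then show ?thesis
    unfolding union_outcomes_def mem_Collect_eq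
    by (intro exI[of _ ?G] exI[of _ ?H])
      (simp only: pg dis outcome_of_game_of[OF fl pg(1) irr(1)] outcome_of_game_of[OF fr pg(2) irr(2)]
        parity_of_game_of[OF fl irr(1)] parity_of_game_of[OF fr irr(2)] simp_thms)
qed

text \<open>One inclusion is the strategic half, valid for all games; the other comes from the
  examples, read in either orientation because the union is commutative.\<close>

lemma union_outcomes_eq:
  assumes "infinite (UNIV :: 'a set)"
  shows "union_outcomes TYPE('a) p c q d = {e. compatible p c q d e}"
proof
  show "union_outcomes TYPE('a) p c q d \<subseteq> {e. compatible p c q d e}"
    using compatible_union by (fastforce simp: union_outcomes_def disjoint_games_def)
  have kinds: "(p, c) \<in> set kinds" for p c
    by (cases p; cases c) (simp_all add: kinds_def)
  have outcomes: "e \<in> set [\<M>, \<N>, \<P>, \<B>]" for e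
    by (cases e) simp_all
  have example: "e \<in> union_outcomes TYPE('a) p c q d"
    if "((p, c), (q, d), e) \<in> set (map classify examples)" for p c q d e
    using that example_union_outcome[OF assms] by (auto simp: kind_of_code_def)
  show "{e. compatible p c q d e} \<subseteq> union_outcomes TYPE('a) p c q d"
  proof
    fix e assume "e \<in> {e. compatible p c q d e}"
    moreover have "realized (map classify examples) ((p, c), (q, d), e)"
      using compatible_realized kinds outcomes unfolding list_all_iff set_product by blast
    ultimately have "((p, c), (q, d), e) \<in> set (map classify examples) \<or>
        ((q, d), (p, c), e) \<in> set (map classify examples)"
      by simp
    then show "e \<in> union_outcomes TYPE('a) p c q d"
      using example union_outcomes_commute by blast
  qed
qed

text \<open>With only four candidates, a comprehension becomes an explicit set, and each entry of
  the table reduces to propositional evaluation of the clauses of \<open>compatible\<close>.\<close>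

lemma Collect_outcome:
  "{e. P e} = (if P \<M> then {\<M>} else {}) \<union> (if P \<N> then {\<N>} else {}) \<union>
     (if P \<P> then {\<P>} else {}) \<union> (if P \<B> then {\<B>} else {})"
    (is "?L = ?R")
proof (rule set_eqI)
  show "e \<in> ?L \<longleftrightarrow> e \<in> ?R" for e
    by (cases e) simp_all
qed

theorem theorem10:
  assumes "infinite (UNIV :: 'a set)"
  shows "let U = union_outcomes TYPE('a) in
    (\<forall>p\<^sub>1 c\<^sub>1 p\<^sub>2 c\<^sub>2. U p\<^sub>1 c\<^sub>1 p\<^sub>2 c\<^sub>2 = U p\<^sub>2 c\<^sub>2 p\<^sub>1 c\<^sub>1) \<and>
    U Even \<M> Even \<M> = {\<M>} \<and>
    U Even \<M> Even \<N> = {\<M>} \<and>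
    U Even \<M> Even \<P> = {\<M>} \<and>
    U Even \<M> Even \<B> = {\<M>} \<and>
    U Even \<N> Even \<N> = {\<M>, \<N>} \<and>
    U Even \<N> Even \<P> = {\<M>} \<and>
    U Even \<N> Even \<B> = {\<M>, \<N>} \<and>
    U Even \<P> Even \<P> = {\<P>} \<and>
    U Even \<P> Even \<B> = {\<P>} \<and>
    U Even \<B> Even \<B> = {\<P>, \<B>} \<and>
    U Even \<M> Odd \<M> = {\<M>} \<and>
    U Even \<M> Odd \<N> = {\<M>, \<N>} \<and>
    U Even \<M> Odd \<P> = {\<M>} \<and>
    U Even \<M> Odd \<B> = {\<M>, \<N>} \<and>
    U Even \<N> Odd \<M> = {\<M>} \<and>
    U Even \<N> Odd \<N> = {\<M>, \<N>} \<and>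
    U Even \<N> Odd \<P> = {\<M>} \<and>
    U Even \<N> Odd \<B> = {\<M>, \<N>, \<P>, \<B>} \<and>
    U Even \<P> Odd \<M> = {\<M>} \<and>
    U Even \<P> Odd \<N> = {\<N>} \<and>
    U Even \<P> Odd \<P> = {\<M>} \<and>
    U Even \<P> Odd \<B> = {\<N>} \<and>
    U Even \<B> Odd \<M> = {\<M>} \<and>
    U Even \<B> Odd \<N> = {\<N>} \<and>
    U Even \<B> Odd \<P> = {\<M>, \<P>} \<and>
    U Even \<B> Odd \<B> = {\<N>, \<B>} \<and>
    U Odd \<M> Odd \<M> = {\<M>} \<and>
    U Odd \<M> Odd \<N> = {\<M>} \<and>
    U Odd \<M> Odd \<P> = {\<M>} \<and>
    U Odd \<M> Odd \<B> = {\<M>, \<N>} \<and>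
    U Odd \<N> Odd \<N> = {\<M>, \<P>} \<and>
    U Odd \<N> Odd \<P> = {\<M>, \<N>} \<and>
    U Odd \<N> Odd \<B> = {\<M>, \<N>, \<P>, \<B>} \<and>
    U Odd \<P> Odd \<P> = {\<M>} \<and>
    U Odd \<P> Odd \<B> = {\<M>, \<N>} \<and>
    U Odd \<B> Odd \<B> = {\<M>, \<N>, \<P>, \<B>}"
  unfolding Let_def union_outcomes_eq[OF assms]
proof (intro conjI)
  show "\<forall>p\<^sub>1 c\<^sub>1 p\<^sub>2 c\<^sub>2. {e. compatible p\<^sub>1 c\<^sub>1 p\<^sub>2 c\<^sub>2 e} = {e. compatible p\<^sub>2 c\<^sub>2 p\<^sub>1 c\<^sub>1 e}"
    using compatible_commute by blast
qed (simp_all add: Collect_outcome compatible_def half_compatible_def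
      maker_wins_first_def maker_wins_second_def insert_commute)

end
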